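(* For every fixed positive integer $d$ and fixed real $a>1$, with $L=\lceil a\log(n)\rceil$, the asymptotic rate of the set $\mathcal{Z}_n(L,d)$ is $1$, that is, $$\lim_{n\to\infty}\frac{\log(Z_n(L,d))}{n}=1.$$
   Context: All logarithms are base 2. For $\mathbf{w}\in\{0,1\}^n$, $\mathbf{w}_{i,L}=(w_i,\dots,w_{i+L-1})$ and $d_H$ is the Hamming distance. A string $\mathbf{w}\in\{0,1\}^n$ is $(L,d)$-substring distant if $d_H(\mathbf{w}_{i,L},\mathbf{w}_{j,L})\ge d$ for all $1\le i<j\le n-L+1$. $\mathcal{Z}_n(L,d)$ is the set of all $(L,d)$-substring distant strings in $\{0,1\}^n$ and $Z_n(L,d)=|\mathcal{Z}_n(L,d)|$. *)

theory Defs
  imports Complex_Main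
begin

(* Binary strings of length n are boolean lists of length n. Positions are 1-based:
   for i >= 1 and i + L <= length w + 1, substr w i L is (w_i, ..., w_{i+L-1}). *)

definition binary_strings :: "nat \<Rightarrow> bool list set" where
  "binary_strings n = {w. length w = n}"

definition substr :: "'a list \<Rightarrow> nat \<Rightarrow> nat \<Rightarrow> 'a list" where
  "substr w i L = take L (drop (i - 1) w)"

(* Only meaningful for lists of equal length. *)
definition hamming_dist :: "'a list \<Rightarrow> 'a list \<Rightarrow> nat" where
  "hamming_dist u v = card {k. k < length u \<and> u ! k \<noteq> v ! k}"

(* The bound j + L <= n + 1 is j <= n - L + 1 without truncated subtraction:
   the condition is vacuous when L > n. *)
definition substring_distant :: "nat \<Rightarrow> nat \<Rightarrow> 'a list \<Rightarrow> bool" where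
  "substring_distant L d w \<longleftrightarrow>
     (\<forall>i j. 1 \<le> i \<and> i < j \<and> j + L \<le> length w + 1 \<longrightarrow>
        d \<le> hamming_dist (substr w i L) (substr w j L))"

definition substring_distant_strings :: "nat \<Rightarrow> nat \<Rightarrow> nat \<Rightarrow> bool list set" where
  "substring_distant_strings n L d = {w \<in> binary_strings n. substring_distant L d w}"

definition num_substring_distant :: "nat \<Rightarrow> nat \<Rightarrow> nat \<Rightarrow> nat" where
  "num_substring_distant n L d = card (substring_distant_strings n L d)"

end

theory Submission
  imports Defs "HOL-Real_Asymp.Real_Asymp"
begin

text \<open>
  Extend a distant string of length \<open>m\<close> by one bit. If the result is not distant, its last window
  of length \<open>L\<close> is at distance less than \<open>d\<close> from some earlier window \<open>i\<close>, and the string can be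
  reconstructed bit by bit from its prefix of length \<open>m + 1 - L\<close> (itself distant) and the set of
  positions where the two windows disagree, even if they overlap. Hence there are at most
  \<open>n d L\<^sup>d Z\<^sub>m\<^sub>+\<^sub>1\<^sub>-\<^sub>L\<close> bad extensions. Inductively \<open>Z\<^sub>m\<close> is at least \<open>\<beta>\<^sup>L\<^sup>-\<^sup>1 Z\<^sub>m\<^sub>+\<^sub>1\<^sub>-\<^sub>L\<close>, so
  \<open>Z\<^sub>m\<^sub>+\<^sub>1 \<ge> \<beta> Z\<^sub>m\<close> as soon as \<open>n d L\<^sup>d \<le> (2 - \<beta>) \<beta>\<^sup>L\<^sup>-\<^sup>1\<close>. With \<open>\<beta> = 2\<^sup>t\<close> the right-hand side
  grows like \<open>n\<^sup>a\<^sup>t\<close>, so every \<open>t < 1\<close> with \<open>a t > 1\<close> is eventually admissible.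
\<close>

section \<open>Windows and their mismatch sets\<close>

text \<open>Positions are 0-based from here on. Keeping the set of offsets, not only its size, is
  what lets a window be reconstructed from an earlier one.\<close>

definition mismatches :: "nat \<Rightarrow> 'a list \<Rightarrow> nat \<Rightarrow> nat \<Rightarrow> nat set" where
  "mismatches L w i j = {k. k < L \<and> w ! (i + k) \<noteq> w ! (j + k)}"

lemma hamming_dist_substr:
  assumes "i \<le> j" "j + L \<le> length w"
  shows "hamming_dist (substr w (Suc i) L) (substr w (Suc j) L) = card (mismatches L w i j)"
proof -
  have "{k. k < length (substr w (Suc i) L) \<and> substr w (Suc i) L ! k \<noteq> substr w (Suc j) L ! k}
      = mismatches L w i j"
    using assms by (auto simp: substr_def mismatches_def)
  then show ?thesis by (simp add: hamming_dist_def)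
qed

lemma substring_distant_iff:
  "substring_distant L d w \<longleftrightarrow>
     (\<forall>i j. i < j \<and> j + L \<le> length w \<longrightarrow> d \<le> card (mismatches L w i j))"
proof
  assume w: "substring_distant L d w"
  show "\<forall>i j. i < j \<and> j + L \<le> length w \<longrightarrow> d \<le> card (mismatches L w i j)"
  proof (intro allI impI)
    fix i j assume "i < j \<and> j + L \<le> length w"
    with w[unfolded substring_distant_def, rule_format, of "Suc i" "Suc j"]
    show "d \<le> card (mismatches L w i j)" by (simp add: hamming_dist_substr)
  qed
next
  assume w: "\<forall>i j. i < j \<and> j + L \<le> length w \<longrightarrow> d \<le> card (mismatches L w i j)"
  show "substring_distant L d w"
    unfolding substring_distant_def
  proof (intro allI impI)
    fix i j assume ij: "1 \<le> i \<and> i < j \<and> j + L \<le> length w + 1"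
    then obtain i' j' where "i = Suc i'" "j = Suc j'"
      by (metis One_nat_def Suc_le_D less_imp_le le_trans)
    with ij w show "d \<le> hamming_dist (substr w i L) (substr w j L)"
      by (simp add: hamming_dist_substr)
  qed
qed

lemma mismatches_take:
  assumes "i \<le> j" "j + L \<le> m"
  shows "mismatches L (take m w) i j = mismatches L w i j"
  using assms by (auto simp: mismatches_def)

lemma substring_distant_take:
  "substring_distant L d w \<Longrightarrow> substring_distant L d (take m w)"
  by (auto simp: substring_distant_iff mismatches_take)

section \<open>Counts of binary strings and short lengths\<close>

lemma finite_binary_strings: "finite (binary_strings n)"
  and card_binary_strings: "card (binary_strings n) = 2 ^ n"
proof -
  have *: "binary_strings n = {xs. set xs \<subseteq> (UNIV :: bool set) \<and> length xs = n}"
    by (simp add: binary_strings_def)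
  show "finite (binary_strings n)"
    unfolding * by (rule finite_lists_length_eq) simp
  show "card (binary_strings n) = 2 ^ n"
    unfolding * by (subst card_lists_length_eq) auto
qed

lemma finite_substring_distant_strings: "finite (substring_distant_strings n L d)"
  by (rule finite_subset[OF _ finite_binary_strings[of n]])
     (auto simp: substring_distant_strings_def)

lemma num_substring_distant_le: "num_substring_distant n L d \<le> 2 ^ n"
  unfolding num_substring_distant_def card_binary_strings[symmetric]
  by (rule card_mono[OF finite_binary_strings]) (auto simp: substring_distant_strings_def)

text \<open>Two windows at different positions need length at least \<open>L + 1\<close>, so the
  condition is vacuous here. This starts the growth induction.\<close>

lemma num_substring_distant_short:
  assumes "m \<le> L"
  shows "num_substring_distant m L d = 2 ^ m"
proof -
  have "substring_distant_strings m L d = binary_strings m"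
    using assms
    by (auto simp: substring_distant_strings_def binary_strings_def substring_distant_iff)
  then show ?thesis by (simp add: num_substring_distant_def card_binary_strings)
qed

section \<open>Strings whose last window is close to an earlier one\<close>

text \<open>Each \<open>k < d\<close> contributes \<open>L choose k\<close>, at most
  \<open>L ^ d\<close>. This is crude, but polylogarithmic in \<open>n\<close> once \<open>L\<close>
  is of order \<open>log n\<close>.\<close>

lemma card_small_subsets_le:
  fixes L d :: nat
  assumes "L \<ge> 1"
  shows "card {S. S \<subseteq> {..<L} \<and> card S < d} \<le> d * L ^ d"
proof -
  have "{S. S \<subseteq> {..<L} \<and> card S < d} = (\<Union>k<d. {S. S \<subseteq> {..<L} \<and> card S = k})"
    by auto
  then have "card {S. S \<subseteq> {..<L} \<and> card S < d} \<le> (\<Sum>k<d. card {S. S \<subseteq> {..<L} \<and> card S = k})"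
    by (simp add: card_UN_le)
  also have "\<dots> = (\<Sum>k<d. L choose k)"
    by (simp add: n_subsets)
  also have "\<dots> \<le> (\<Sum>k<d. L ^ d)"
  proof (rule sum_mono)
    fix k assume "k \<in> {..<d}"
    then have "L ^ k \<le> L ^ d" using assms by (intro power_increasing) auto
    moreover have "L choose k \<le> L ^ k"
      by (cases "k \<le> L") (auto simp: binomial_le_pow binomial_eq_0)
    ultimately show "L choose k \<le> L ^ d" by linarith
  qed
  finally show ?thesis by simp
qed

text \<open>Bits from \<open>j\<close> on are recovered left to right: bit \<open>j + l\<close>
  equals or negates bit \<open>i + l\<close>, as the mismatch set dictates.\<close>

lemma eq_of_mismatches_eq:
  fixes v w :: "bool list"
  assumes len: "length v = j + L" "length w = j + L" and "i < j"
    and pre: "take j v = take j w" and mis: "mismatches L v i j = mismatches L w i j"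
  shows "v = w"
proof -
  have "k < j + L \<Longrightarrow> v ! k = w ! k" for k
  proof (induction k rule: less_induct)
    case (less k)
    show ?case
    proof (cases "k < j")
      case True
      then show ?thesis by (metis pre nth_take)
    next
      case False
      then obtain l where l: "k = j + l" by (metis le_Suc_ex not_less)
      \<comment> \<open>As \<open>i + l < j + l\<close>, this bit is already known, even if the
        windows overlap and \<open>i + l \<ge> j\<close>.\<close>
      have "v ! (i + l) = w ! (i + l)"
        using less.IH[of "i + l"] less.prems \<open>i < j\<close> l by simp
      moreover have "l \<in> mismatches L v i j \<longleftrightarrow> l \<in> mismatches L w i j"
        using mis by simp
      ultimately show ?thesis
        using less.prems l by (auto simp: mismatches_def)
    qed
  qed
  then show ?thesis using len by (intro nth_equalityI) auto
qed

text \<open>The prefix of length \<open>j\<close> and a set of fewer than \<open>d\<close> offsets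
  encode such a string injectively.\<close>

lemma card_close_windows_le:
  assumes "L \<ge> 1" "i < j"
  shows "card {w \<in> binary_strings (j + L). substring_distant L d (take j w) \<and>
            card (mismatches L w i j) < d}
          \<le> d * L ^ d * num_substring_distant j L d" (is "card ?A \<le> _")
proof -
  let ?T = "{S. S \<subseteq> {..<L} \<and> card S < d}"
  have "inj_on (\<lambda>w. (take j w, mismatches L w i j)) ?A"
    using \<open>i < j\<close> by (intro inj_onI) (auto simp: binary_strings_def intro: eq_of_mismatches_eq)
  moreover have "(\<lambda>w. (take j w, mismatches L w i j)) ` ?A \<subseteq> substring_distant_strings j L d \<times> ?T"
    by (auto simp: substring_distant_strings_def binary_strings_def mismatches_def)
  ultimately have "card ?A \<le> card (substring_distant_strings j L d \<times> ?T)"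
    by (rule card_inj_on_le) (simp add: finite_substring_distant_strings)
  also have "\<dots> \<le> num_substring_distant j L d * (d * L ^ d)"
    unfolding card_cartesian_product num_substring_distant_def
    by (intro mult_left_mono card_small_subsets_le assms) simp
  finally show ?thesis by (simp add: mult_ac)
qed

section \<open>One-bit extensions\<close>

lemma card_extensions:
  "card {w \<in> binary_strings (Suc m). substring_distant L d (take m w)}
     = 2 * num_substring_distant m L d"
proof -
  have "{w \<in> binary_strings (Suc m). substring_distant L d (take m w)}
      = (\<lambda>(u, b). u @ [b]) ` (substring_distant_strings m L d \<times> UNIV)" (is "?E = ?f ` ?X")
  proof (intro equalityI subsetI)
    fix w assume w: "w \<in> ?E"
    then have "w = ?f (take m w, last w)"
      by (cases w rule: rev_cases) (auto simp: binary_strings_def)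
    moreover have "(take m w, last w) \<in> ?X"
      using w by (auto simp: substring_distant_strings_def binary_strings_def)
    ultimately show "w \<in> ?f ` ?X" by (rule image_eqI)
  qed (auto simp: substring_distant_strings_def binary_strings_def)
  moreover have "inj_on ?f ?X" by (auto simp: inj_on_def)
  ultimately show ?thesis
    by (simp add: card_image card_cartesian_product num_substring_distant_def)
qed

text \<open>Union bound over \<open>i < j\<close>, where \<open>j\<close> is the start of the last
  window: every pair of windows avoiding that one lies in the prefix of length
  \<open>m\<close>.\<close>

lemma num_substring_distant_Suc_ge:
  assumes "L \<ge> 1" "Suc m = j + L"
  shows "2 * num_substring_distant m L d
    \<le> num_substring_distant (Suc m) L d + j * (d * L ^ d * num_substring_distant j L d)"
proof -
  let ?E = "{w \<in> binary_strings (Suc m). substring_distant L d (take m w)}"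
  let ?G = "substring_distant_strings (Suc m) L d"
  let ?A = "\<lambda>i. {w \<in> binary_strings (j + L). substring_distant L d (take j w) \<and>
                  card (mismatches L w i j) < d}"
  have "?E \<subseteq> ?G \<union> (\<Union>i<j. ?A i)"
  proof
    fix w assume w: "w \<in> ?E"
    then have len: "length w = j + L" and good: "substring_distant L d (take m w)"
      using assms by (auto simp: binary_strings_def)
    \<comment> \<open>\<open>L \<ge> 1\<close> gives \<open>j \<le> m\<close>, so the double prefix
      collapses to \<open>take j w\<close>.\<close>
    have "substring_distant L d (take j (take m w))"
      using good by (rule substring_distant_take)
    then have pre: "substring_distant L d (take j w)"
      using assms by (simp add: min_def split: if_splits)
    show "w \<in> ?G \<union> (\<Union>i<j. ?A i)"
    proof (cases "\<exists>i<j. card (mismatches L w i j) < d")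
      case True
      then show ?thesis using w pre assms by auto
    next
      case distant: False
      have "d \<le> card (mismatches L w i' j')" if "i' < j'" "j' + L \<le> length w" for i' j'
      proof (cases "j' = j")
        case True
        then show ?thesis using distant that by (metis not_less)
      next
        case False
        then have "j' + L \<le> m" using that len assms by simp
        moreover have "d \<le> card (mismatches L (take m w) i' j')"
          using good that \<open>j' + L \<le> m\<close> by (auto simp: substring_distant_iff)
        ultimately show ?thesis using that by (simp add: mismatches_take)
      qed
      then show ?thesis
        using w by (auto simp: substring_distant_strings_def substring_distant_iff)
    qed
  qed
  moreover have "finite (?G \<union> (\<Union>i<j. ?A i))"
    by (auto simp: finite_substring_distant_strings intro: finite_subset[OF _ finite_binary_strings])
  ultimately have "card ?E \<le> card (?G \<union> (\<Union>i<j. ?A i))"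
    by (intro card_mono)
  also have "\<dots> \<le> card ?G + card (\<Union>i<j. ?A i)" by (rule card_Un_le)
  also have "card (\<Union>i<j. ?A i) \<le> (\<Sum>i<j. card (?A i))" by (rule card_UN_le) simp
  also have "\<dots> \<le> (\<Sum>i<j. d * L ^ d * num_substring_distant j L d)"
    by (intro sum_mono card_close_windows_le assms) simp
  finally show ?thesis by (simp add: card_extensions num_substring_distant_def)
qed

section \<open>Exponential growth\<close>

text \<open>By \<open>slack\<close> and the induction hypothesis on the \<open>L - 1\<close>
  preceding lengths, at most \<open>2 - \<beta>\<close> times the count at \<open>m\<close> is lost
  out of its double. With \<open>n\<close> fixed, one inequality serves all
  \<open>m < n\<close>.\<close>

lemma num_substring_distant_growth:
  fixes \<beta> :: real
  assumes "L \<ge> 1" "0 < \<beta>" "\<beta> \<le> 2"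
    and slack: "real n * (real d * real L ^ d) \<le> (2 - \<beta>) * \<beta> ^ (L - 1)"
  shows "m < n \<Longrightarrow> \<beta> * num_substring_distant m L d \<le> num_substring_distant (Suc m) L d"
proof (induction m rule: less_induct)
  case (less m)
  let ?Z = "\<lambda>m. real (num_substring_distant m L d)"
  show ?case
  proof (cases "m < L")
    case True
    \<comment> \<open>Both lengths are at most \<open>L\<close>, so the count exactly
      doubles.\<close>
    then show ?thesis using assms by (simp add: num_substring_distant_short)
  next
    case False
    define j where "j = Suc m - L"
    have j: "Suc m = j + L" "m = j + (L - 1)" using False \<open>L \<ge> 1\<close> by (auto simp: j_def)
    \<comment> \<open>Every length \<open>j + l\<close> stepped from is below \<open>m\<close>, and
      \<open>l = L - 1\<close> reaches \<open>m\<close> itself.\<close>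
    have iter: "l \<le> L - 1 \<Longrightarrow> \<beta> ^ l * ?Z j \<le> ?Z (j + l)" for l
    proof (induction l)
      case (Suc l)
      have "\<beta> ^ Suc l * ?Z j \<le> \<beta> * ?Z (j + l)"
        using Suc \<open>0 < \<beta>\<close> by (simp add: mult.assoc)
      also have "\<dots> \<le> ?Z (Suc (j + l))"
        using Suc.prems less.prems j by (intro less.IH) auto
      finally show ?case by simp
    qed simp
    have "real (2 * num_substring_distant m L d)
      \<le> real (num_substring_distant (Suc m) L d + j * (d * L ^ d * num_substring_distant j L d))"
      using num_substring_distant_Suc_ge[OF \<open>L \<ge> 1\<close> j(1), of d] by (simp only: of_nat_le_iff)
    then have "2 * ?Z m \<le> ?Z (Suc m) + real j * (real d * real L ^ d) * ?Z j"
      by (simp add: mult_ac)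
    also have "real j * (real d * real L ^ d) * ?Z j \<le> real n * (real d * real L ^ d) * ?Z j"
      using less.prems j \<open>L \<ge> 1\<close> by (intro mult_right_mono) auto
    also have "\<dots> \<le> (2 - \<beta>) * \<beta> ^ (L - 1) * ?Z j"
      by (rule mult_right_mono[OF slack]) simp
    also have "\<dots> \<le> (2 - \<beta>) * ?Z m"
      using iter[of "L - 1"] assms j by (simp add: mult.assoc mult_left_mono)
    finally show ?thesis by (simp add: algebra_simps)
  qed
qed

lemma num_substring_distant_ge_power:
  fixes \<beta> :: real
  assumes "L \<ge> 1" "0 < \<beta>" "\<beta> \<le> 2"
    and "real n * (real d * real L ^ d) \<le> (2 - \<beta>) * \<beta> ^ (L - 1)"
  shows "\<beta> ^ n \<le> num_substring_distant n L d"
proof -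
  have "m \<le> n \<Longrightarrow> \<beta> ^ m \<le> num_substring_distant m L d" for m
  proof (induction m)
    case 0
    then show ?case by (simp add: num_substring_distant_short)
  next
    case (Suc m)
    then have "\<beta> ^ Suc m \<le> \<beta> * num_substring_distant m L d"
      using \<open>0 < \<beta>\<close> by simp
    also have "\<dots> \<le> num_substring_distant (Suc m) L d"
      using Suc.prems by (intro num_substring_distant_growth[OF assms]) simp
    finally show ?case .
  qed
  then show ?thesis by simp
qed

section \<open>Asymptotics in \<open>n\<close> and the limit\<close>

text \<open>Since \<open>L n\<close> is at least \<open>a * log 2 n\<close>, the power
  \<open>(2 powr t) ^ L n\<close> is at least \<open>n powr (a * t)\<close>. Dividing by
  \<open>n\<close> leaves a positive power of \<open>n\<close>, which beats the polylogarithmic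
  factor.\<close>

lemma eventually_slack:
  fixes a t :: real and d :: nat
  assumes "a > 0" "a * t > 1" "0 < t" "t < 1"
  defines "L \<equiv> \<lambda>n. nat \<lceil>a * log 2 (real n)\<rceil>"
  shows "\<forall>\<^sub>F n in sequentially. L n \<ge> 1 \<and>
    real n * (real d * real (L n) ^ d) \<le> (2 - 2 powr t) * (2 powr t) ^ (L n - 1)"
proof -
  \<comment> \<open>The denominator pays for the exponent \<open>L n - 1\<close> in place of
    \<open>L n\<close>.\<close>
  define c where "c = (2 - 2 powr t) / 2 powr t"
  have "2 powr t < 2 powr (1::real)" using assms by (intro powr_less_mono) auto
  then have c: "c > 0" by (simp add: c_def)
  define s where "s = a * t - 1"
  have s: "s > 0" using assms by (simp add: s_def)
  have "((\<lambda>n. real d * (a * log 2 (real n) + 1) powr real d / real n powr s) \<longlongrightarrow> 0) sequentially"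
    using s \<open>a > 0\<close> by real_asymp
  then have "\<forall>\<^sub>F n in sequentially.
      real d * (a * log 2 (real n) + 1) powr real d / real n powr s < c"
    using c by (rule order_tendstoD)
  then show ?thesis
    using eventually_gt_at_top[of 1]
  proof eventually_elim
    case (elim n)
    let ?x = "a * log 2 (real n)"
    have x: "?x > 0" using elim \<open>a > 0\<close> by simp
    then have L: "L n \<ge> 1" "?x \<le> real (L n)" "real (L n) \<le> ?x + 1"
      by (auto simp: L_def) linarith+
    have "real d * real (L n) ^ d \<le> real d * (?x + 1) powr real d"
      using L x by (auto simp: powr_realpow intro!: mult_left_mono power_mono)
    also have "\<dots> \<le> c * real n powr s"
      using elim by (simp add: field_simps)
    finally have "real n * (real d * real (L n) ^ d) \<le> real n * (c * real n powr s)"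
      by (rule mult_left_mono) simp
    also have "\<dots> = c * (real n * real n powr s)"
      by simp
    also have "real n * real n powr s = (2 powr log 2 (real n)) powr (a * t)"
      using elim by (simp add: s_def powr_diff)
    also have "\<dots> = 2 powr (t * ?x)"
      by (simp add: powr_powr mult_ac)
    also have "\<dots> \<le> 2 powr (t * real (L n))"
      using L \<open>0 < t\<close> by simp
    also have "\<dots> = (2 powr t) ^ L n"
      by (simp add: powr_powr[symmetric] powr_realpow)
    also have "\<dots> = 2 powr t * (2 powr t) ^ (L n - 1)"
      using L by (simp add: power_eq_if)
    also have "c * \<dots> = (2 - 2 powr t) * (2 powr t) ^ (L n - 1)"
      by (simp add: c_def)
    finally show ?case using L c by simp
  qed
qed

theorem theorem19:
  fixes d :: nat and a :: real
  assumes "d \<ge> 1" and "a > 1"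
  shows "(\<lambda>n. log 2 (real (num_substring_distant n (nat \<lceil>a * log 2 (real n)\<rceil>) d)) / real n)
           \<longlonglongrightarrow> 1"
proof -
  define L where "L = (\<lambda>n. nat \<lceil>a * log 2 (real n)\<rceil>)"
  define R where "R = (\<lambda>n. log 2 (real (num_substring_distant n (L n) d)) / real n)"
  \<comment> \<open>The lower bound holds for any \<open>t\<close> strictly between
    \<open>1 / a\<close> and \<open>1\<close>; the upper one comes from counting all
    strings.\<close>
  have lower: "\<forall>\<^sub>F n in sequentially. t \<le> R n \<and> R n \<le> 1"
    if t: "a * t > 1" "0 < t" "t < 1" for t
  proof -
    have "\<forall>\<^sub>F n in sequentially. L n \<ge> 1 \<and>
        real n * (real d * real (L n) ^ d) \<le> (2 - 2 powr t) * (2 powr t) ^ (L n - 1)"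
      unfolding L_def using \<open>a > 1\<close> t by (intro eventually_slack) auto
    then show ?thesis
      using eventually_gt_at_top[of 0]
    proof eventually_elim
      case (elim n)
      let ?Z = "real (num_substring_distant n (L n) d)"
      have "2 powr t \<le> 2 powr (1::real)" using t by (intro powr_mono) auto
      then have "(2 powr t) ^ n \<le> ?Z"
        using elim by (intro num_substring_distant_ge_power) auto
      moreover have "(2 powr t) ^ n = 2 powr (t * real n)"
        by (simp add: powr_powr[symmetric] powr_realpow)
      ultimately have ge: "2 powr (t * real n) \<le> ?Z" by simp
      \<comment> \<open>A positive count is required before passing to logarithms.\<close>
      moreover have "(0::real) < 2 powr (t * real n)" by simp
      ultimately have pos: "?Z > 0" by linarith
      have "t * real n \<le> log 2 ?Z"
        using ge pos by (simp add: le_log_iff)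
      moreover have "?Z \<le> 2 powr real n"
        using num_substring_distant_le[of n "L n" d]
        by (metis of_nat_le_iff of_nat_numeral of_nat_power powr_realpow zero_less_numeral)
      then have "log 2 ?Z \<le> real n"
        using pos by (simp add: log_le_iff)
      ultimately show ?case
        using elim by (simp add: R_def field_simps)
    qed
  qed
  have "R \<longlonglongrightarrow> 1"
  proof (rule order_tendstoI)
    fix y :: real assume "y < 1"
    have a: "0 < 1 / a" "1 / a < 1" using \<open>a > 1\<close> by auto
    then obtain t where "max y (1 / a) < t" "t < 1"
      using \<open>y < 1\<close> dense[of "max y (1 / a)" 1] by auto
    then have "y < t" "1 / a < t" "t < 1" by simp_all
    moreover from this have "0 < t" using a by linarith
    moreover have "a * t > 1" using \<open>1 / a < t\<close> \<open>a > 1\<close> by (simp add: field_simps)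
    ultimately show "\<forall>\<^sub>F n in sequentially. y < R n"
      using lower[of t] by (auto elim!: eventually_mono)
  next
    fix y :: real assume "1 < y"
    \<comment> \<open>Only the upper bound in \<open>lower\<close> matters here, so any admissible
      \<open>t\<close> will do; this is the midpoint of \<open>1 / a\<close> and
      \<open>1\<close>.\<close>
    define t where "t = (1 + 1 / a) / 2"
    have "a * t > 1" "0 < t" "t < 1" using \<open>a > 1\<close> by (auto simp: t_def field_simps)
    then show "\<forall>\<^sub>F n in sequentially. R n < y"
      using lower[of t] \<open>1 < y\<close> by (auto elim!: eventually_mono)
  qed
  then show ?thesis by (simp add: R_def L_def)
qed

end
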